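(* Let $(X,\mathsf a)$ be a complete action space with the approximate mid-point property. Suppose in addition that $\mathsf a$ is uniformly superlinear and that $X$ is endowed with a topology $\sigma$ such that $(X,\sigma)$ is compact and $\mathsf a$ is $\sigma$-lower semicontinuous in the sense that for every $\tau>0$ and all sequences $u_i^n\to u_i$ in $\sigma$ as $n\to\infty$, $i=0,1$, one has $\liminf_{n\to\infty}\mathsf a(\tau,u_0^n,u_1^n)\ge\mathsf a(\tau,u_0,u_1)$. Then for every $\tau>0$ and $u_0,u_1\in X$ there exists $\omega_{\mathrm{opt}}:[0,\tau]\to X$ with $\omega_{\mathrm{opt}}(0)=u_0$, $\omega_{\mathrm{opt}}(\tau)=u_1$ such that $$\mathsf a(\tau,u_0,u_1)=\mathbb A(\omega_{\mathrm{opt}};[0,\tau])=\min\{\mathbb A(\Theta;[0,\tau]):\ \Theta:[0,\tau]\to X,\ \Theta(0)=u_0,\ \Theta(\tau)=u_1\}.$$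
   Context: An action cost on a set $X$ is a function $\mathsf a:(0,+\infty)\times X\times X\to[0,+\infty)$ such that for all $\tau,\tau_1,\tau_2>0$ and $u_1,u_2,u_3\in X$: (i) $\mathsf a(\tau,u_1,u_2)=0$ if and only if $u_1=u_2$; (ii) $\mathsf a(\tau,u_1,u_2)=\mathsf a(\tau,u_2,u_1)$; (iii) $\mathsf a(\tau_1+\tau_2,u_1,u_3)\le \mathsf a(\tau_1,u_1,u_2)+\mathsf a(\tau_2,u_2,u_3)$. The pair $(X,\mathsf a)$ is called an action space. A sequence $(u_n)$ in $X$ converges to $u$ (with respect to $\mathsf a$) if $\mathsf a(\tau,u_n,u)\to0$ for every $\tau>0$; it is Cauchy if for all $\tau,c>0$ there is $\bar n$ with $\mathsf a(\tau,u_n,u_m)<c$ for all $n,m\ge\bar n$; $(X,\mathsf a)$ is complete if every Cauchy sequence converges. $(X,\mathsf a)$ has the approximate mid-point property if for all $\rho>0$, all $u,v\in X$ and all sufficiently small $\epsilon>0$ there exists $w\in X$ with $\mathsf a(\rho/2,u,w)+\mathsf a(\rho/2,w,v)\le\mathsf a(\rho,u,v)+\epsilon$. The action cost $\mathsf a$ is uniformly superlinear if there exist an action cost $\mathsf b$ on $X$, a convex superlinear function $\psi:[0,+\infty)\to[0,+\infty)$ (i.e. $\lim_{r\to+\infty}\psi(r)/r=+\infty$), and a constant $\lambda\ge1$ such that $\lambda^{-1}\tau\,\psi(\tau^{-1}\mathsf b(\tau,u,v))\le\mathsf a(\tau,u,v)\le\lambda\tau\,\psi(\tau^{-1}\mathsf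 b(\tau,u,v))$ for every $\tau>0$, $u,v\in X$. The $\mathsf a$-action of a curve $\Theta:[0,\tau]\to X$ is $\mathbb A(\Theta;[0,\tau]):=\sup\sum_{j=1}^M\mathsf a(t^j-t^{j-1},\Theta(t^{j-1}),\Theta(t^j))$, the supremum being over all finite partitions $0=t^0<t^1<\dots<t^M=\tau$.
   Formalization: "(X,σ) is compact" is taken as sequentially compact; with covering compactness and only sequential lower semicontinuity the claim fails (a complete non-geodesic length space with cost d²/τ, carrying the topology of βN). *)

theory Defs
  imports "HOL-Analysis.Analysis"
begin

text \<open>The set \<open>X\<close> is an explicit carrier, and a cost is a total function of which only the values
  at positive times and points of \<open>X\<close> are ever constrained or used.\<close>

definition action_cost :: "'a set \<Rightarrow> (real \<Rightarrow> 'a \<Rightarrow> 'a \<Rightarrow> real) \<Rightarrow> bool" where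
  "action_cost X a \<longleftrightarrow>
     (\<forall>\<tau>>0. \<forall>u\<in>X. \<forall>v\<in>X. 0 \<le> a \<tau> u v) \<and>
     (\<forall>\<tau>>0. \<forall>u\<in>X. \<forall>v\<in>X. a \<tau> u v = 0 \<longleftrightarrow> u = v) \<and>
     (\<forall>\<tau>>0. \<forall>u\<in>X. \<forall>v\<in>X. a \<tau> u v = a \<tau> v u) \<and>
     (\<forall>\<tau>1>0. \<forall>\<tau>2>0. \<forall>u\<in>X. \<forall>v\<in>X. \<forall>w\<in>X. a (\<tau>1 + \<tau>2) u w \<le> a \<tau>1 u v + a \<tau>2 v w)"

definition action_convergent ::
    "(real \<Rightarrow> 'a \<Rightarrow> 'a \<Rightarrow> real) \<Rightarrow> (nat \<Rightarrow> 'a) \<Rightarrow> 'a \<Rightarrow> bool" where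
  "action_convergent a u l \<longleftrightarrow> (\<forall>\<tau>>0. (\<lambda>n. a \<tau> (u n) l) \<longlonglongrightarrow> 0)"

definition action_Cauchy :: "(real \<Rightarrow> 'a \<Rightarrow> 'a \<Rightarrow> real) \<Rightarrow> (nat \<Rightarrow> 'a) \<Rightarrow> bool" where
  "action_Cauchy a u \<longleftrightarrow> (\<forall>\<tau>>0. \<forall>c>0. \<exists>N. \<forall>n\<ge>N. \<forall>m\<ge>N. a \<tau> (u n) (u m) < c)"

definition action_complete :: "'a set \<Rightarrow> (real \<Rightarrow> 'a \<Rightarrow> 'a \<Rightarrow> real) \<Rightarrow> bool" where
  "action_complete X a \<longleftrightarrow>
     (\<forall>u. (\<forall>n. u n \<in> X) \<longrightarrow> action_Cauchy a u \<longrightarrow> (\<exists>l\<in>X. action_convergent a u l))"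

text \<open>How small \<open>\<epsilon>\<close> has to be may depend on \<open>\<rho>\<close>, \<open>u\<close> and \<open>v\<close>.\<close>

definition approx_midpoint :: "'a set \<Rightarrow> (real \<Rightarrow> 'a \<Rightarrow> 'a \<Rightarrow> real) \<Rightarrow> bool" where
  "approx_midpoint X a \<longleftrightarrow>
     (\<forall>\<rho>>0. \<forall>u\<in>X. \<forall>v\<in>X. \<forall>\<^sub>F \<epsilon> in at_right 0.
        \<exists>w\<in>X. a (\<rho> / 2) u w + a (\<rho> / 2) w v \<le> a \<rho> u v + \<epsilon>)"

definition uniformly_superlinear :: "'a set \<Rightarrow> (real \<Rightarrow> 'a \<Rightarrow> 'a \<Rightarrow> real) \<Rightarrow> bool" where
  "uniformly_superlinear X a \<longleftrightarrow>
     (\<exists>b (\<psi> :: real \<Rightarrow> real) \<Lambda>.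
        action_cost X b \<and>
        (\<forall>r\<ge>0. 0 \<le> \<psi> r) \<and> convex_on {0..} \<psi> \<and> filterlim (\<lambda>r. \<psi> r / r) at_top at_top \<and>
        1 \<le> \<Lambda> \<and>
        (\<forall>\<tau>>0. \<forall>u\<in>X. \<forall>v\<in>X.
           inverse \<Lambda> * \<tau> * \<psi> (inverse \<tau> * b \<tau> u v) \<le> a \<tau> u v \<and>
           a \<tau> u v \<le> \<Lambda> * \<tau> * \<psi> (inverse \<tau> * b \<tau> u v)))"

text \<open>Compactness of \<open>\<sigma>\<close> is sequential compactness (as in \<^const>\<open>seq_compact\<close>, here for abstract
  topologies), which is what matches the sequential lower semicontinuity below. No Hausdorff or
  countability axiom is assumed. With covering compactness alone the existence theorem fails: for
  \<open>\<sigma>\<close> compact in which all convergent sequences are eventually constant (e.g. the topology of the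
  Stone-Cech compactification of the naturals), lower semicontinuity along sequences is vacuous, and
  the cost \<open>(dist u v)\<^sup>2 / \<tau>\<close> of a complete non-geodesic length space of the same cardinality is a
  counterexample.\<close>

definition seq_compact_space :: "'a topology \<Rightarrow> bool" where
  "seq_compact_space \<sigma> \<longleftrightarrow>
     (\<forall>u :: nat \<Rightarrow> 'a. (\<forall>n. u n \<in> topspace \<sigma>) \<longrightarrow>
        (\<exists>l\<in>topspace \<sigma>. \<exists>r :: nat \<Rightarrow> nat. strict_mono r \<and> limitin \<sigma> (u \<circ> r) l sequentially))"

definition action_lsc :: "'a topology \<Rightarrow> (real \<Rightarrow> 'a \<Rightarrow> 'a \<Rightarrow> real) \<Rightarrow> bool" where
  "action_lsc \<sigma> a \<longleftrightarrow>
     (\<forall>\<tau>>0. \<forall>(x :: nat \<Rightarrow> 'a) (y :: nat \<Rightarrow> 'a) u v.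
        (\<forall>n. x n \<in> topspace \<sigma>) \<longrightarrow> (\<forall>n. y n \<in> topspace \<sigma>) \<longrightarrow>
        limitin \<sigma> x u sequentially \<longrightarrow> limitin \<sigma> y v sequentially \<longrightarrow>
        ereal (a \<tau> u v) \<le> liminf (\<lambda>n. ereal (a \<tau> (x n) (y n))))"

text \<open>The action of a curve on \<open>[0,\<tau>]\<close>, possibly infinite; the \<open>M + 1\<close> nodes of a partition are
  \<open>t 0, \<dots>, t M\<close>. It does not depend on the values of \<open>\<Theta>\<close> outside \<open>[0,\<tau>]\<close>.\<close>

definition curve_action ::
    "(real \<Rightarrow> 'a \<Rightarrow> 'a \<Rightarrow> real) \<Rightarrow> real \<Rightarrow> (real \<Rightarrow> 'a) \<Rightarrow> ereal" where
  "curve_action a \<tau> \<Theta> =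
     Sup {ereal (\<Sum>j=1..M. a (t j - t (j - 1)) (\<Theta> (t (j - 1))) (\<Theta> (t j))) | M (t :: nat \<Rightarrow> real).
            t 0 = 0 \<and> t M = \<tau> \<and> (\<forall>j\<in>{1..M}. t (j - 1) < t j)}"

text \<open>Arbitrary curves: no continuity or measurability is required.\<close>

definition curves_between :: "'a set \<Rightarrow> real \<Rightarrow> 'a \<Rightarrow> 'a \<Rightarrow> (real \<Rightarrow> 'a) set" where
  "curves_between X \<tau> u v = {\<Theta> \<in> {0..\<tau>} \<rightarrow> X. \<Theta> 0 = u \<and> \<Theta> \<tau> = v}"

end

theory Submission
  imports Defs
begin

text \<open>Every curve from \<open>u\<close> to \<open>v\<close> over the duration \<open>\<tau>\<close> has action at least \<open>a \<tau> u v\<close>, as the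
  partition without interior nodes shows (\<open>curve_action_ge\<close>). So it suffices to construct a curve
  whose action is at most \<open>A = a \<tau> u v\<close>.

  Compactness and lower semicontinuity turn approximate midpoints into exact ones
  (\<open>exact_midpoint\<close>). Repeated bisection gives points at all dyadic fractions of \<open>[0, \<tau>]\<close> such that
  at every level the costs of the consecutive steps add up to at most \<open>A\<close>
  (\<open>dyadic_points_sum_le\<close>); hence the cost between two of these points at different times, over the duration that
  separates them, is at most \<open>A\<close> too. By itself this says nothing about continuity, since the cost
  of a fixed pair may grow as the duration shrinks. Superlinearity supplies the missing estimate: pairs
  of bounded cost over a very short duration have small cost over any fixed duration
  (\<open>uniformly_superlinear_modulus\<close>). So dyadic points at times tending to \<open>t\<close> form a Cauchy
  sequence, and completeness gives their limit \<open>\<omega> t\<close>, the same for all such sequences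
  (\<open>dyadic_limit_curve\<close>).

  The action bound survives the limit because the cost is lower semicontinuous along action
  convergent sequences as well (\<open>action_lsc_action_convergent\<close>). That property holds for a fixed
  duration, and the cost need not be continuous in the duration; but it is nonincreasing in it, so
  each interval of a partition is approximated by dyadic intervals from inside
  (\<open>dyadic_limit_curve_action_le\<close>).\<close>

section \<open>Action costs\<close>

lemma action_cost_nonneg: "action_cost X a \<Longrightarrow> 0 < \<tau> \<Longrightarrow> u \<in> X \<Longrightarrow> v \<in> X \<Longrightarrow> 0 \<le> a \<tau> u v"
  by (simp add: action_cost_def)

lemma action_cost_eq_0_iff:
  "action_cost X a \<Longrightarrow> 0 < \<tau> \<Longrightarrow> u \<in> X \<Longrightarrow> v \<in> X \<Longrightarrow> a \<tau> u v = 0 \<longleftrightarrow> u = v"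
  by (simp add: action_cost_def)

lemma action_cost_sym: "action_cost X a \<Longrightarrow> 0 < \<tau> \<Longrightarrow> u \<in> X \<Longrightarrow> v \<in> X \<Longrightarrow> a \<tau> u v = a \<tau> v u"
  by (simp add: action_cost_def)

lemma action_cost_triangle:
  "action_cost X a \<Longrightarrow> 0 < \<tau>1 \<Longrightarrow> 0 < \<tau>2 \<Longrightarrow> u \<in> X \<Longrightarrow> v \<in> X \<Longrightarrow> w \<in> X \<Longrightarrow>
    a (\<tau>1 + \<tau>2) u w \<le> a \<tau>1 u v + a \<tau>2 v w"
  by (simp add: action_cost_def)

text \<open>Reaching the target early and waiting there costs nothing.\<close>

lemma action_cost_antimono:
  assumes "action_cost X a" "0 < \<delta>" "\<delta> \<le> T" "u \<in> X" "v \<in> X"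
  shows "a T u v \<le> a \<delta> u v"
proof (cases "\<delta> = T")
  case False
  then have "a (\<delta> + (T - \<delta>)) u v \<le> a \<delta> u v + a (T - \<delta>) v v"
    using assms by (intro action_cost_triangle) auto
  moreover have "a (T - \<delta>) v v = 0"
    using False assms by (subst action_cost_eq_0_iff) auto
  ultimately show ?thesis by simp
qed simp

text \<open>The triangle inequality along a chain of equal time steps; the time \<open>T\<close> may exceed the total
  duration, because lattice approximations of a partition interval are shorter than the interval.\<close>

lemma action_cost_chain_le_sum:
  assumes a: "action_cost X a" and h: "0 < h" and w: "\<And>k. w k \<in> X"
    and "i \<le> k" "0 < T" "h * real (k - i) \<le> T"
  shows "a T (w i) (w k) \<le> (\<Sum>l=i..<k. a h (w l) (w (Suc l)))"
proof (cases "i = k")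
  case True
  then show ?thesis using action_cost_eq_0_iff[OF a, of T "w k" "w k"] assms by simp
next
  case False
  then have "i < k" using assms by simp
  have "a (h * real (k - i)) (w i) (w k) \<le> (\<Sum>l=i..<k. a h (w l) (w (Suc l)))"
    using \<open>i < k\<close>
  proof (induction k rule: less_Suc_induct)
    case (1 i)
    then show ?case by simp
  next
    case (2 i j k)
    have "h * real (k - i) = h * real (j - i) + h * real (k - j)"
      using 2 by (simp add: of_nat_diff algebra_simps)
    then have "a (h * real (k - i)) (w i) (w k)
        \<le> a (h * real (j - i)) (w i) (w j) + a (h * real (k - j)) (w j) (w k)"
      using 2 h w by (simp, intro action_cost_triangle[OF a]) auto
    also have "\<dots> \<le> (\<Sum>l=i..<j. a h (w l) (w (Suc l))) + (\<Sum>l=j..<k. a h (w l) (w (Suc l)))"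
      using 2 by (intro add_mono) auto
    also have "\<dots> = (\<Sum>l=i..<k. a h (w l) (w (Suc l)))"
      using 2 by (simp add: sum.atLeastLessThan_concat)
    finally show ?case .
  qed
  moreover have "a T (w i) (w k) \<le> a (h * real (k - i)) (w i) (w k)"
    using assms \<open>i < k\<close> by (intro action_cost_antimono[OF a]) auto
  ultimately show ?thesis by simp
qed

lemma action_convergent_unique:
  assumes a: "action_cost X a" and x: "\<And>n. x n \<in> X" and "u \<in> X" "v \<in> X"
    and u: "action_convergent a x u" and v: "action_convergent a x v"
  shows "u = v"
proof -
  have "(\<lambda>n. a 1 (x n) u + a 1 (x n) v) \<longlonglongrightarrow> 0 + 0"
    using u v by (intro tendsto_add) (auto simp: action_convergent_def)
  moreover have "a (1 + 1) u v \<le> a 1 (x n) u + a 1 (x n) v" for n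
    using action_cost_triangle[OF a, of 1 1 u "x n" v] action_cost_sym[OF a, of 1 u "x n"]
      x[of n] assms by simp
  ultimately have "a (1 + 1) u v \<le> 0 + 0"
    by (intro LIMSEQ_le_const) auto
  then show ?thesis
    using action_cost_nonneg[OF a, of 2 u v] action_cost_eq_0_iff[OF a, of 2 u v] assms by simp
qed

section \<open>Lower semicontinuity and exact midpoints\<close>

text \<open>Lower semicontinuity is joint in the two end points, so both have to converge along one common
  subsequence.\<close>

lemma seq_compact_space_pair:
  assumes "seq_compact_space \<sigma>" "\<And>n. x n \<in> topspace \<sigma>" "\<And>n. y n \<in> topspace \<sigma>"
  obtains u v and r :: "nat \<Rightarrow> nat" where "u \<in> topspace \<sigma>" "v \<in> topspace \<sigma>" "strict_mono r"
    "limitin \<sigma> (x \<circ> r) u sequentially" "limitin \<sigma> (y \<circ> r) v sequentially"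
proof -
  obtain u r where u: "u \<in> topspace \<sigma>" "strict_mono (r :: nat \<Rightarrow> nat)"
      "limitin \<sigma> (x \<circ> r) u sequentially"
    using assms unfolding seq_compact_space_def by blast
  obtain v s where v: "v \<in> topspace \<sigma>" "strict_mono (s :: nat \<Rightarrow> nat)"
      "limitin \<sigma> ((y \<circ> r) \<circ> s) v sequentially"
    using assms(1) assms(3) unfolding seq_compact_space_def by (metis comp_apply)
  have "limitin \<sigma> ((x \<circ> r) \<circ> s) u sequentially"
    using limitin_subsequence[OF v(2) u(3)] .
  then show thesis
    using that[of u v "r \<circ> s"] u v by (simp add: comp_assoc strict_mono_o)
qed

lemma action_lsc_le:
  assumes lsc: "action_lsc \<sigma> a" and "0 < \<tau>" "\<And>n. x n \<in> topspace \<sigma>" "\<And>n. y n \<in> topspace \<sigma>"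
    and "limitin \<sigma> x u sequentially" "limitin \<sigma> y v sequentially"
    and "\<And>n. a \<tau> (x n) (y n) \<le> C n" "C \<longlonglongrightarrow> c"
  shows "a \<tau> u v \<le> c"
proof -
  have "ereal (a \<tau> u v) \<le> liminf (\<lambda>n. ereal (a \<tau> (x n) (y n)))"
    using assms unfolding action_lsc_def by blast
  also have "\<dots> \<le> liminf (\<lambda>n. ereal (C n))"
    using assms by (intro Liminf_mono) auto
  also have "\<dots> = ereal c"
    using assms by (intro lim_imp_Liminf) auto
  finally show ?thesis by simp
qed

text \<open>Topological limits are not unique without a Hausdorff axiom, but the cost is lower semicontinuous
  and separates points, so an action limit is the only possible topological limit.\<close>

lemma action_limit_eq_topological_limit:
  assumes a: "action_cost X a" and X: "topspace \<sigma> = X" and lsc: "action_lsc \<sigma> a"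
    and x: "\<And>n. x n \<in> X" and "u \<in> X" "z \<in> X"
    and u: "action_convergent a x u" and z: "limitin \<sigma> x z sequentially"
  shows "z = u"
proof -
  have "a 1 z u \<le> 0"
  proof (rule action_lsc_le[OF lsc])
    show "limitin \<sigma> x z sequentially" by fact
    show "limitin \<sigma> (\<lambda>_. u) u sequentially" using assms by (simp add: limitin_const_iff)
    show "(\<lambda>n. a 1 (x n) u) \<longlonglongrightarrow> 0" using u by (simp add: action_convergent_def)
  qed (use assms in auto)
  then show ?thesis
    using action_cost_nonneg[OF a, of 1 z u] action_cost_eq_0_iff[OF a, of 1 z u] assms by simp
qed

lemma action_convergent_subseq:
  "action_convergent a x u \<Longrightarrow> strict_mono (r :: nat \<Rightarrow> nat) \<Longrightarrow> action_convergent a (x \<circ> r) u"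
  unfolding action_convergent_def
  by (auto intro: LIMSEQ_subseq_LIMSEQ[where f = r, unfolded comp_def] simp: comp_def)

text \<open>Lower semicontinuity passes from the topology to action convergence: otherwise a subsequence
  violates the inequality, and compactness gives a further subsequence that converges in the
  topology, necessarily to the action limits.\<close>

lemma action_lsc_action_convergent:
  assumes a: "action_cost X a" and X: "topspace \<sigma> = X"
    and comp: "seq_compact_space \<sigma>" and lsc: "action_lsc \<sigma> a"
    and x: "\<And>n. x n \<in> X" and y: "\<And>n. y n \<in> X" and "u \<in> X" "v \<in> X"
    and u: "action_convergent a x u" and v: "action_convergent a y v"
    and "0 < T" "0 < \<epsilon>"
  shows "\<forall>\<^sub>F n in sequentially. a T u v < a T (x n) (y n) + \<epsilon>"
proof (rule ccontr)
  assume "\<not> ?thesis"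
  then have "\<exists>\<^sub>\<infinity>n. a T (x n) (y n) + \<epsilon> \<le> a T u v"
    by (simp add: frequently_def not_le cofinite_eq_sequentially)
  then obtain r :: "nat \<Rightarrow> nat" where r: "strict_mono r"
      "\<And>n. a T (x (r n)) (y (r n)) + \<epsilon> \<le> a T u v"
    using infinite_enumerate[of "{n. a T (x n) (y n) + \<epsilon> \<le> a T u v}"]
    by (auto simp: INFM_iff_infinite)
  obtain p q s where s: "p \<in> X" "q \<in> X" "strict_mono (s :: nat \<Rightarrow> nat)"
      "limitin \<sigma> ((x \<circ> r) \<circ> s) p sequentially" "limitin \<sigma> ((y \<circ> r) \<circ> s) q sequentially"
    using seq_compact_space_pair[OF comp, of "x \<circ> r" "y \<circ> r"] x y unfolding X
    by (metis comp_apply)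
  have "action_convergent a ((x \<circ> r) \<circ> s) u" "action_convergent a ((y \<circ> r) \<circ> s) v"
    using u v r(1) s(3) by (auto intro!: action_convergent_subseq)
  then have "p = u" "q = v"
    using action_limit_eq_topological_limit[OF a X lsc, of "(x \<circ> r) \<circ> s" u p]
      action_limit_eq_topological_limit[OF a X lsc, of "(y \<circ> r) \<circ> s" v q] s x y assms by simp_all
  then have lim: "limitin \<sigma> ((x \<circ> r) \<circ> s) u sequentially" "limitin \<sigma> ((y \<circ> r) \<circ> s) v sequentially"
    using s by simp_all
  have "a T u v \<le> a T u v - \<epsilon>"
  proof (rule action_lsc_le[OF lsc \<open>0 < T\<close> _ _ lim _ tendsto_const])
    fix n
    show "a T (((x \<circ> r) \<circ> s) n) (((y \<circ> r) \<circ> s) n) \<le> a T u v - \<epsilon>"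
      using r(2)[of "s n"] by simp
  qed (use x y X in simp_all)
  then show False using \<open>0 < \<epsilon>\<close> by simp
qed

text \<open>A topological limit point of approximate midpoints with errors tending to \<open>0\<close>. The liminf of a
  sum dominates the sum of the liminfs, so the two halves need not converge separately.\<close>

lemma exact_midpoint:
  assumes a: "action_cost X a" and mid: "approx_midpoint X a" and X: "topspace \<sigma> = X"
    and comp: "seq_compact_space \<sigma>" and lsc: "action_lsc \<sigma> a"
    and "0 < \<rho>" "u \<in> X" "v \<in> X"
  shows "\<exists>w\<in>X. a (\<rho> / 2) u w + a (\<rho> / 2) w v \<le> a \<rho> u v"
proof -
  have "\<forall>\<^sub>F \<epsilon> in at_right 0. \<exists>w\<in>X. a (\<rho> / 2) u w + a (\<rho> / 2) w v \<le> a \<rho> u v + \<epsilon>"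
    using assms unfolding approx_midpoint_def by blast
  then obtain b where b: "0 < b"
      "\<And>\<epsilon>. 0 < \<epsilon> \<Longrightarrow> \<epsilon> < b \<Longrightarrow> \<exists>w\<in>X. a (\<rho> / 2) u w + a (\<rho> / 2) w v \<le> a \<rho> u v + \<epsilon>"
    unfolding eventually_at_right_field by auto
  \<comment> \<open>The offset \<open>2\<close> keeps every error strictly below the threshold \<open>b\<close>.\<close>
  define e where "e n = b / real (n + 2)" for n
  have e: "0 < e n" "e n < b" for n using b(1) by (auto simp: e_def divide_less_eq)
  have "e \<longlonglongrightarrow> 0"
    unfolding e_def by (intro LIMSEQ_ignore_initial_segment lim_const_over_n)
  obtain w where w: "\<And>n. w n \<in> X" "\<And>n. a (\<rho> / 2) u (w n) + a (\<rho> / 2) (w n) v \<le> a \<rho> u v + e n"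
    using b(2)[OF e] by metis
  obtain z r where r: "z \<in> X" "strict_mono (r :: nat \<Rightarrow> nat)" "limitin \<sigma> (w \<circ> r) z sequentially"
    using comp w(1) X unfolding seq_compact_space_def by blast
  have "ereal (a (\<rho> / 2) u z) \<le> liminf (\<lambda>n. ereal (a (\<rho> / 2) u (w (r n))))"
    "ereal (a (\<rho> / 2) z v) \<le> liminf (\<lambda>n. ereal (a (\<rho> / 2) (w (r n)) v))"
    using lsc[unfolded action_lsc_def, rule_format, of "\<rho> / 2" "\<lambda>_. u" "w \<circ> r" u z]
      lsc[unfolded action_lsc_def, rule_format, of "\<rho> / 2" "w \<circ> r" "\<lambda>_. v" z v]
      r w X assms by (simp_all add: limitin_const_iff)
  then have "ereal (a (\<rho> / 2) u z) + ereal (a (\<rho> / 2) z v)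
      \<le> liminf (\<lambda>n. ereal (a (\<rho> / 2) u (w (r n)))) + liminf (\<lambda>n. ereal (a (\<rho> / 2) (w (r n)) v))"
    by (rule add_mono)
  also have "\<dots> \<le> liminf (\<lambda>n. ereal (a (\<rho> / 2) u (w (r n))) + ereal (a (\<rho> / 2) (w (r n)) v))"
    using w(1) assms(6-8) by (intro Liminf_add_le always_eventually allI)
      (auto intro!: action_cost_nonneg[OF a])
  also have "\<dots> \<le> liminf (\<lambda>n. ereal (a \<rho> u v + e (r n)))"
    using w(2) by (intro Liminf_mono) auto
  also have "\<dots> = ereal (a \<rho> u v + 0)"
    by (intro lim_imp_Liminf tendsto_ereal tendsto_add tendsto_const
        LIMSEQ_subseq_LIMSEQ[OF \<open>e \<longlonglongrightarrow> 0\<close> r(2), unfolded comp_def]) auto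
  finally show ?thesis using r(1) by auto
qed

section \<open>The modulus of continuity given by superlinearity\<close>

text \<open>Superlinearity of \<open>\<psi>\<close> bounds the auxiliary cost \<open>b\<close> uniformly by a quantity that vanishes with
  the duration, on all pairs of bounded action; as \<open>b\<close> decreases in time and \<open>\<psi>\<close> vanishes
  continuously at \<open>0\<close>, the action over any fixed longer duration is small as well.\<close>

lemma uniformly_superlinear_modulus:
  assumes a: "action_cost X a" and "uniformly_superlinear X a" and "0 < T" "0 < c" "0 \<le> A"
  shows "\<exists>\<delta>0>0. \<forall>\<delta> u v. 0 < \<delta> \<longrightarrow> \<delta> \<le> \<delta>0 \<longrightarrow> u \<in> X \<longrightarrow> v \<in> X \<longrightarrow> a \<delta> u v \<le> A \<longrightarrow> a T u v < c"
proof -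
  obtain b \<psi> \<Lambda> where b: "action_cost X b" and \<psi>0: "\<And>r. 0 \<le> r \<Longrightarrow> 0 \<le> \<psi> r"
    and conv: "convex_on {0..} \<psi>" and lim: "filterlim (\<lambda>r::real. \<psi> r / r) at_top at_top"
    and \<Lambda>: "1 \<le> (\<Lambda>::real)"
    and lower: "\<And>\<tau> u v. 0 < \<tau> \<Longrightarrow> u \<in> X \<Longrightarrow> v \<in> X \<Longrightarrow>
      inverse \<Lambda> * \<tau> * \<psi> (inverse \<tau> * b \<tau> u v) \<le> a \<tau> u v"
    and upper: "\<And>\<tau> u v. 0 < \<tau> \<Longrightarrow> u \<in> X \<Longrightarrow> v \<in> X \<Longrightarrow>
      a \<tau> u v \<le> \<Lambda> * \<tau> * \<psi> (inverse \<tau> * b \<tau> u v)"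
    using assms(2) unfolding uniformly_superlinear_def by blast
  \<comment> \<open>\<open>b T u v \<le> \<eta>\<close> will give \<open>a T u v \<le> \<Lambda> * \<psi> 1 * \<eta> < c\<close>; the bound by \<open>T\<close> puts the argument of
    \<open>\<psi>\<close> into \<open>[0, 1]\<close>.\<close>
  define \<eta> where "\<eta> = min T (c / (\<Lambda> * (\<psi> 1 + 1)))"
  have \<psi>1: "0 \<le> \<psi> 1" using \<psi>0 by simp
  have "0 < \<Lambda> * (\<psi> 1 + 1)" using \<Lambda> \<psi>1 by simp
  then have \<eta>: "0 < \<eta>" "\<eta> \<le> T" "\<eta> * (\<Lambda> * (\<psi> 1 + 1)) \<le> c"
    unfolding \<eta>_def using assms by (simp_all flip: pos_le_divide_eq)
  \<comment> \<open>With this slope, \<open>b \<delta> u v > \<eta>\<close> for a short duration \<open>\<delta>\<close> would force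
    \<open>\<delta> * \<psi> (b \<delta> u v / \<delta>) > \<Lambda> * A\<close>, against the lower bound of \<open>a\<close>.\<close>
  obtain R0 where R0: "\<And>r. R0 \<le> r \<Longrightarrow> (\<Lambda> * A + 1) / \<eta> \<le> \<psi> r / r"
    using lim unfolding filterlim_at_top eventually_at_top_linorder by metis
  define R where "R = max R0 1"
  have R: "0 < R" "\<And>r. R \<le> r \<Longrightarrow> (\<Lambda> * A + 1) / \<eta> \<le> \<psi> r / r"
    using R0 by (auto simp: R_def)
  have "a T u v < c"
    if \<delta>: "0 < \<delta>" "\<delta> \<le> min T (\<eta> / R)" and X: "u \<in> X" "v \<in> X" and le: "a \<delta> u v \<le> A" for \<delta> u v
  proof -
    have "b \<delta> u v \<le> \<eta>"
    proof (rule ccontr)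
      assume "\<not> b \<delta> u v \<le> \<eta>"
      then have \<beta>: "\<eta> < b \<delta> u v" by simp
      define r where "r = inverse \<delta> * b \<delta> u v"
      have "\<eta> / \<delta> < r" using \<beta> \<delta> by (simp add: r_def field_simps)
      moreover have "R \<le> \<eta> / \<delta>" using \<delta> R(1) by (simp add: field_simps)
      ultimately have r: "R \<le> r" "0 < r" using R(1) by linarith+
      have "\<eta> < r * \<delta>" using \<open>\<eta> / \<delta> < r\<close> \<delta> by (simp add: pos_divide_less_eq)
      have "\<Lambda> * A + 1 \<le> (\<Lambda> * A + 1) / \<eta> * (r * \<delta>)"
        using \<open>\<eta> < r * \<delta>\<close> \<eta> \<Lambda> assms mult_left_mono[of \<eta> "r * \<delta>" "\<Lambda> * A + 1"]
        by (simp add: pos_le_divide_eq)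
      also have "\<dots> \<le> \<psi> r / r * (r * \<delta>)"
        using R(2)[OF r(1)] r \<delta> by (intro mult_right_mono) auto
      also have "\<dots> = \<Lambda> * (inverse \<Lambda> * \<delta> * \<psi> r)" using r \<Lambda> by simp
      also have "\<dots> \<le> \<Lambda> * A"
        using lower[OF \<delta>(1) X] le \<Lambda> by (intro mult_left_mono) (auto simp: r_def)
      finally show False by simp
    qed
    define s where "s = inverse T * b T u v"
    have "b T u v \<le> \<eta>"
      using action_cost_antimono[OF b, of \<delta> T u v] \<delta> X \<open>b \<delta> u v \<le> \<eta>\<close> by simp
    moreover have "0 \<le> b T u v" using action_cost_nonneg[OF b] X assms by simp
    ultimately have s: "0 \<le> s" "T * s \<le> \<eta>" "s \<le> 1"
      using \<eta> \<open>0 < T\<close> by (auto simp: s_def field_simps)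
    \<comment> \<open>A constant curve has no action, which forces \<open>\<psi> 0 = 0\<close>; convexity then gives \<open>\<psi> s \<le> s * \<psi> 1\<close>.\<close>
    have "\<psi> 0 = 0"
    proof -
      have "a T u u = 0" "b T u u = 0"
        using action_cost_eq_0_iff[OF a] action_cost_eq_0_iff[OF b] X assms by auto
      then have "inverse \<Lambda> * T * \<psi> 0 \<le> 0" using lower[of T u u] X assms by simp
      then show ?thesis using \<Lambda> \<open>0 < T\<close> \<psi>0[of 0]
        by (simp add: mult_le_0_iff zero_less_mult_iff)
    qed
    have "\<psi> ((1 - s) *\<^sub>R 0 + s *\<^sub>R 1) \<le> (1 - s) * \<psi> 0 + s * \<psi> 1"
      using s by (intro convex_onD[OF conv]) auto
    then have "\<psi> s \<le> s * \<psi> 1" using \<open>\<psi> 0 = 0\<close> by simp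
    have "a T u v \<le> \<Lambda> * T * \<psi> s" using upper X assms by (simp add: s_def)
    also have "\<dots> \<le> \<Lambda> * T * (s * \<psi> 1)"
      using \<open>\<psi> s \<le> s * \<psi> 1\<close> \<Lambda> \<open>0 < T\<close> by (intro mult_left_mono) auto
    also have "\<dots> = (T * s) * (\<Lambda> * \<psi> 1)" by simp
    also have "\<dots> \<le> \<eta> * (\<Lambda> * \<psi> 1)" using s \<psi>1 \<Lambda> by (intro mult_right_mono) auto
    also have "\<dots> < \<eta> * (\<Lambda> * (\<psi> 1 + 1))" using \<eta> \<Lambda> by simp
    also have "\<dots> \<le> c" by (rule \<eta>)
    finally show ?thesis .
  qed
  then show ?thesis using \<eta>(1) R(1) \<open>0 < T\<close> by (intro exI[of _ "min T (\<eta> / R)"]) auto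
qed

section \<open>Dyadic subdivision\<close>

text \<open>\<open>dyadic_points m \<tau> u v n k\<close> is the point of the curve at time \<open>k * \<tau> / 2 ^ n\<close>, where \<open>m \<rho> x y\<close>
  is a midpoint of \<open>x\<close> and \<open>y\<close> for the duration \<open>\<rho>\<close>. At indices \<open>k > 2 ^ n\<close>
  it still lies in the space.\<close>

primrec dyadic_points ::
    "(real \<Rightarrow> 'a \<Rightarrow> 'a \<Rightarrow> 'a) \<Rightarrow> real \<Rightarrow> 'a \<Rightarrow> 'a \<Rightarrow> nat \<Rightarrow> nat \<Rightarrow> 'a" where
  "dyadic_points m \<tau> u v 0 = (\<lambda>k. if k = 0 then u else v)"
| "dyadic_points m \<tau> u v (Suc n) = (\<lambda>k.
     if even k then dyadic_points m \<tau> u v n (k div 2)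
     else m (\<tau> / 2 ^ n) (dyadic_points m \<tau> u v n (k div 2)) (dyadic_points m \<tau> u v n (Suc (k div 2))))"

lemma dyadic_points_in:
  assumes "\<And>\<rho> x y. 0 < \<rho> \<Longrightarrow> x \<in> X \<Longrightarrow> y \<in> X \<Longrightarrow> m \<rho> x y \<in> X" "0 < \<tau>" "u \<in> X" "v \<in> X"
  shows "dyadic_points m \<tau> u v n k \<in> X"
  by (induction n arbitrary: k) (use assms in auto)

lemma dyadic_points_first: "dyadic_points m \<tau> u v n 0 = u"
  by (induction n) auto

lemma dyadic_points_refine:
  "dyadic_points m \<tau> u v (n + j) (2 ^ j * k) = dyadic_points m \<tau> u v n k"
  by (induction j arbitrary: k) (auto simp: mult.assoc)

lemma dyadic_points_last: "dyadic_points m \<tau> u v n (2 ^ n) = v"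
  using dyadic_points_refine[of m \<tau> u v 0 n 1] by simp

text \<open>Inserting an exact midpoint into a step does not increase its cost.\<close>

lemma dyadic_points_sum_le:
  fixes a :: "real \<Rightarrow> 'a \<Rightarrow> 'a \<Rightarrow> real"
  assumes m: "\<And>\<rho> x y. 0 < \<rho> \<Longrightarrow> x \<in> X \<Longrightarrow> y \<in> X \<Longrightarrow>
      m \<rho> x y \<in> X \<and> a (\<rho> / 2) x (m \<rho> x y) + a (\<rho> / 2) (m \<rho> x y) y \<le> a \<rho> x y"
    and "0 < \<tau>" "u \<in> X" "v \<in> X"
  defines "W \<equiv> dyadic_points m \<tau> u v"
  shows "(\<Sum>k<2 ^ n. a (\<tau> / 2 ^ n) (W n k) (W n (Suc k))) \<le> a \<tau> u v"
proof (induction n)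
  case 0
  then show ?case by (simp add: W_def)
next
  case (Suc n)
  have W: "W n k \<in> X" for n k
    unfolding W_def using assms by (intro dyadic_points_in) auto
  define h where "h = \<tau> / 2 ^ n"
  have h: "0 < h" "\<tau> / 2 ^ Suc n = h / 2" using assms by (auto simp: h_def)
  have "(\<Sum>k<2 * K. a (h / 2) (W (Suc n) k) (W (Suc n) (Suc k))) \<le> (\<Sum>k<K. a h (W n k) (W n (Suc k)))"
    for K
  proof (induction K)
    case (Suc K)
    have "W (Suc n) (2 * K) = W n K" "W (Suc n) (Suc (Suc (2 * K))) = W n (Suc K)"
      "W (Suc n) (Suc (2 * K)) = m h (W n K) (W n (Suc K))"
      by (simp_all add: W_def h_def)
    then show ?case using Suc m[OF h(1) W[of n K] W[of n "Suc K"]] by simp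
  qed simp
  from this[of "2 ^ n"] Suc show ?case unfolding h(2) by (simp add: h_def)
qed

text \<open>Two points of the subdivision, of whatever levels, lie on a common finer one; the part of its
  chain between them has action at most that of the whole chain.\<close>

lemma dyadic_points_cost_le:
  assumes a: "action_cost X a"
    and m: "\<And>\<rho> x y. 0 < \<rho> \<Longrightarrow> x \<in> X \<Longrightarrow> y \<in> X \<Longrightarrow>
      m \<rho> x y \<in> X \<and> a (\<rho> / 2) x (m \<rho> x y) + a (\<rho> / 2) (m \<rho> x y) y \<le> a \<rho> x y"
    and \<tau>: "0 < \<tau>" and uv: "u \<in> X" "v \<in> X"
    and p: "p \<le> 2 ^ n" and q: "q \<le> 2 ^ j" and \<delta>: "0 < \<delta>"
      "\<bar>\<tau> * (real p / 2 ^ n) - \<tau> * (real q / 2 ^ j)\<bar> \<le> \<delta>"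
  shows "a \<delta> (dyadic_points m \<tau> u v n p) (dyadic_points m \<tau> u v j q) \<le> a \<tau> u v"
proof -
  define W where "W = dyadic_points m \<tau> u v"
  have W: "W n k \<in> X" for n k
    unfolding W_def using assms by (intro dyadic_points_in) auto
  define N where "N = n + j"
  define h where "h = \<tau> / 2 ^ N"
  have h: "0 < h" using \<tau> by (simp add: h_def)
  have chain: "a \<delta> (W N i) (W N k) \<le> a \<tau> u v" if "i \<le> k" "k \<le> 2 ^ N" "h * real (k - i) \<le> \<delta>" for i k
  proof -
    have "a \<delta> (W N i) (W N k) \<le> (\<Sum>l=i..<k. a h (W N l) (W N (Suc l)))"
      using that \<delta> W h by (intro action_cost_chain_le_sum[OF a]) auto
    also have "\<dots> \<le> (\<Sum>l<2 ^ N. a h (W N l) (W N (Suc l)))"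
      using that W h by (intro sum_mono2) (auto intro: action_cost_nonneg[OF a])
    also have "\<dots> \<le> a \<tau> u v"
      unfolding h_def W_def using dyadic_points_sum_le[of X m a \<tau> u v N] m \<tau> uv by blast
    finally show ?thesis .
  qed
  have eq: "W n p = W N (2 ^ j * p)" "W j q = W N (2 ^ n * q)"
    using dyadic_points_refine[of m \<tau> u v n j p] dyadic_points_refine[of m \<tau> u v j n q]
    by (auto simp: W_def N_def add.commute)
  have le: "2 ^ j * p \<le> 2 ^ N" "2 ^ n * q \<le> 2 ^ N"
    using p q by (auto simp: N_def power_add mult.commute)
  have "\<tau> * (real p / 2 ^ n) = h * real (2 ^ j * p)" "\<tau> * (real q / 2 ^ j) = h * real (2 ^ n * q)"
    by (auto simp: h_def N_def power_add field_simps)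
  with \<delta> have d: "\<bar>h * real (2 ^ j * p) - h * real (2 ^ n * q)\<bar> \<le> \<delta>" by simp
  consider "2 ^ j * p \<le> 2 ^ n * q" | "2 ^ n * q \<le> 2 ^ j * p" by linarith
  then have "a \<delta> (W n p) (W j q) \<le> a \<tau> u v"
  proof cases
    case 1
    then show ?thesis unfolding eq using le d
      by (intro chain) (auto simp del: of_nat_mult simp: of_nat_diff right_diff_distrib)
  next
    case 2
    then have "a \<delta> (W N (2 ^ n * q)) (W N (2 ^ j * p)) \<le> a \<tau> u v" using le d
      by (intro chain) (auto simp del: of_nat_mult simp: of_nat_diff right_diff_distrib)
    then show ?thesis unfolding eq using action_cost_sym[OF a \<delta>(1)] W by metis
  qed
  then show ?thesis by (simp add: W_def)
qed

text \<open>Lattice points within one step of time \<open>t\<close> are separated by a duration that vanishes as the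
  levels grow, while their cost over that duration is at most \<open>a \<tau> u v\<close>; the modulus of continuity
  applies. Allowing a whole step covers rounding \<open>t\<close> down as well as up.\<close>

lemma dyadic_points_close:
  assumes a: "action_cost X a" and sup: "uniformly_superlinear X a"
    and m: "\<And>\<rho> x y. 0 < \<rho> \<Longrightarrow> x \<in> X \<Longrightarrow> y \<in> X \<Longrightarrow>
      m \<rho> x y \<in> X \<and> a (\<rho> / 2) x (m \<rho> x y) + a (\<rho> / 2) (m \<rho> x y) y \<le> a \<rho> x y"
    and \<tau>: "0 < \<tau>" and uv: "u \<in> X" "v \<in> X" and "0 < T" "0 < c"
  shows "\<exists>N. \<forall>n\<ge>N. \<forall>j\<ge>N. \<forall>p q t.
      p \<le> 2 ^ n \<longrightarrow> \<bar>real p - 2 ^ n * (t / \<tau>)\<bar> \<le> 1 \<longrightarrow> q \<le> 2 ^ j \<longrightarrow> \<bar>real q - 2 ^ j * (t / \<tau>)\<bar> \<le> 1 \<longrightarrow>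
      a T (dyadic_points m \<tau> u v n p) (dyadic_points m \<tau> u v j q) < c"
proof -
  define W where "W = dyadic_points m \<tau> u v"
  have W: "W n k \<in> X" for n k
    unfolding W_def using assms by (intro dyadic_points_in) auto
  obtain \<delta> where \<delta>: "0 < \<delta>"
    "\<And>x y. x \<in> X \<Longrightarrow> y \<in> X \<Longrightarrow> a \<delta> x y \<le> a \<tau> u v \<Longrightarrow> a T x y < c"
    using uniformly_superlinear_modulus[OF a sup \<open>0 < T\<close> \<open>0 < c\<close>, of "a \<tau> u v"]
      action_cost_nonneg[OF a \<tau> uv] by (metis order_refl)
  obtain N where N: "(1 / 2) ^ N < \<delta> / (2 * \<tau>)"
    using real_arch_pow_inv[of "\<delta> / (2 * \<tau>)" "1 / 2"] \<delta> \<tau> by auto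
  have step: "\<bar>\<tau> * (real p / 2 ^ n) - t\<bar> \<le> \<delta> / 2"
    if "N \<le> n" "\<bar>real p - 2 ^ n * (t / \<tau>)\<bar> \<le> 1" for n p t
  proof -
    have "\<tau> * (real p / 2 ^ n) - t = \<tau> / 2 ^ n * (real p - 2 ^ n * (t / \<tau>))"
      using \<tau> by (simp add: field_simps)
    then have "\<bar>\<tau> * (real p / 2 ^ n) - t\<bar> = \<tau> / 2 ^ n * \<bar>real p - 2 ^ n * (t / \<tau>)\<bar>"
      using \<tau> by (simp add: abs_mult)
    also have "\<dots> \<le> \<tau> / 2 ^ n * 1" using that \<tau> by (intro mult_left_mono) auto
    also have "\<dots> \<le> \<tau> * (1 / 2) ^ N"
      using that(1) \<tau> by (simp add: power_divide frac_le)
    also have "\<dots> \<le> \<tau> * (\<delta> / (2 * \<tau>))" using N \<tau> by (intro mult_left_mono) auto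
    finally show ?thesis using \<tau> by simp
  qed
  have "a T (W n p) (W j q) < c"
    if "N \<le> n" "N \<le> j" "p \<le> 2 ^ n" "\<bar>real p - 2 ^ n * (t / \<tau>)\<bar> \<le> 1"
      "q \<le> 2 ^ j" "\<bar>real q - 2 ^ j * (t / \<tau>)\<bar> \<le> 1" for n j p q t
  proof (rule \<delta>(2)[OF W W])
    have "\<bar>\<tau> * (real p / 2 ^ n) - \<tau> * (real q / 2 ^ j)\<bar> \<le> \<delta>"
      using step[OF that(1,4)] step[OF that(2,6)] by linarith
    then show "a \<delta> (W n p) (W j q) \<le> a \<tau> u v"
      unfolding W_def using that m \<delta> by (intro dyadic_points_cost_le[OF a _ \<tau> uv]) auto
  qed
  then show ?thesis unfolding W_def by blast
qed

section \<open>The optimal curve\<close>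

text \<open>The trivial partition with the two nodes \<open>0\<close> and \<open>\<tau>\<close>.\<close>

lemma curve_action_ge:
  assumes "0 < \<tau>"
  shows "ereal (a \<tau> (\<Theta> 0) (\<Theta> \<tau>)) \<le> curve_action a \<tau> \<Theta>"
  unfolding curve_action_def
  by (rule Sup_upper, rule CollectI, rule exI[of _ 1], rule exI[of _ "\<lambda>j. if j = 0 then 0 else \<tau>"])
    (use assms in auto)

text \<open>The sequences \<open>p\<close> are arbitrary roundings of \<open>t\<close> to the lattice: the same \<open>\<omega> t\<close> has to be
  reached from the left, as the right end of a partition interval, and from the right, as the left
  end of the next one.\<close>

lemma dyadic_limit_curve:
  assumes a: "action_cost X a" and complete: "action_complete X a" and sup: "uniformly_superlinear X a"
    and m: "\<And>\<rho> x y. 0 < \<rho> \<Longrightarrow> x \<in> X \<Longrightarrow> y \<in> X \<Longrightarrow>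
      m \<rho> x y \<in> X \<and> a (\<rho> / 2) x (m \<rho> x y) + a (\<rho> / 2) (m \<rho> x y) y \<le> a \<rho> x y"
    and \<tau>: "0 < \<tau>" and uv: "u \<in> X" "v \<in> X"
  defines "W \<equiv> dyadic_points m \<tau> u v"
  obtains \<omega> where "\<And>t. t \<in> {0..\<tau>} \<Longrightarrow> \<omega> t \<in> X"
    "\<And>t p. t \<in> {0..\<tau>} \<Longrightarrow> (\<And>n. p n \<le> 2 ^ n) \<Longrightarrow> (\<And>n. \<bar>real (p n) - 2 ^ n * (t / \<tau>)\<bar> \<le> 1) \<Longrightarrow>
      action_convergent a (\<lambda>n. W n (p n)) (\<omega> t)"
proof -
  have W: "W n k \<in> X" for n k
    unfolding W_def using assms by (intro dyadic_points_in) auto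
  have close: "\<exists>N. \<forall>n\<ge>N. \<forall>j\<ge>N. \<forall>p q t.
      p \<le> 2 ^ n \<longrightarrow> \<bar>real p - 2 ^ n * (t / \<tau>)\<bar> \<le> 1 \<longrightarrow> q \<le> 2 ^ j \<longrightarrow> \<bar>real q - 2 ^ j * (t / \<tau>)\<bar> \<le> 1 \<longrightarrow>
      a T (W n p) (W j q) < c" if "0 < T" "0 < c" for T c
    unfolding W_def using dyadic_points_close[OF a sup _ \<tau> uv that] m by blast
  \<comment> \<open>Rounding down selects the limit; closeness carries it over to every other rounding.\<close>
  define f where "f t n = nat \<lfloor>2 ^ n * (t / \<tau>)\<rfloor>" for t n
  have f: "f t n \<le> 2 ^ n" "\<bar>real (f t n) - 2 ^ n * (t / \<tau>)\<bar> \<le> 1" if "t \<in> {0..\<tau>}" for t n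
  proof -
    have t: "0 \<le> 2 ^ n * (t / \<tau>)" "2 ^ n * (t / \<tau>) \<le> 2 ^ n"
      using that \<tau> by (auto intro: mult_left_le simp del: times_divide_eq_right)
    have "real (f t n) = of_int \<lfloor>2 ^ n * (t / \<tau>)\<rfloor>" unfolding f_def using t by simp
    then show "\<bar>real (f t n) - 2 ^ n * (t / \<tau>)\<bar> \<le> 1" by linarith
    have "real (f t n) \<le> real (2 ^ n)"
      unfolding \<open>real (f t n) = _\<close>
      by (rule order_trans[OF of_int_floor_le]) (use t(2) in simp)
    then show "f t n \<le> 2 ^ n" by linarith
  qed
  have "\<exists>l\<in>X. action_convergent a (\<lambda>n. W n (f t n)) l" if t: "t \<in> {0..\<tau>}" for t
  proof -
    have "action_Cauchy a (\<lambda>n. W n (f t n))"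
      unfolding action_Cauchy_def
    proof (intro allI impI)
      fix T c :: real assume "0 < T" "0 < c"
      from close[OF this] obtain N where N: "\<forall>n\<ge>N. \<forall>j\<ge>N. \<forall>p q t.
          p \<le> 2 ^ n \<longrightarrow> \<bar>real p - 2 ^ n * (t / \<tau>)\<bar> \<le> 1 \<longrightarrow> q \<le> 2 ^ j \<longrightarrow> \<bar>real q - 2 ^ j * (t / \<tau>)\<bar> \<le> 1 \<longrightarrow>
          a T (W n p) (W j q) < c" ..
      show "\<exists>N. \<forall>n\<ge>N. \<forall>j\<ge>N. a T (W n (f t n)) (W j (f t j)) < c"
        by (intro exI[of _ N] allI impI N[rule_format, where t = t] f[OF t])
    qed
    then show ?thesis
      by (rule complete[unfolded action_complete_def, rule_format, OF W])
  qed
  then have "\<exists>\<omega>. \<forall>t\<in>{0..\<tau>}. \<omega> t \<in> X \<and> action_convergent a (\<lambda>n. W n (f t n)) (\<omega> t)"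
    by (intro bchoice) blast
  then obtain \<omega> where \<omega>: "\<And>t. t \<in> {0..\<tau>} \<Longrightarrow> \<omega> t \<in> X"
    "\<And>t. t \<in> {0..\<tau>} \<Longrightarrow> action_convergent a (\<lambda>n. W n (f t n)) (\<omega> t)"
    by blast
  have "action_convergent a (\<lambda>n. W n (p n)) (\<omega> t)"
    if t: "t \<in> {0..\<tau>}" and p: "\<And>n. p n \<le> 2 ^ n" "\<And>n. \<bar>real (p n) - 2 ^ n * (t / \<tau>)\<bar> \<le> 1" for t p
    unfolding action_convergent_def
  proof (intro allI impI)
    fix T :: real assume T: "0 < T"
    have "(\<lambda>n. a (T / 2) (W n (p n)) (W n (f t n))) \<longlonglongrightarrow> 0"
    proof (rule LIMSEQ_I)
      fix c :: real assume "0 < c"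
      with T have "0 < T / 2" "0 < c" by simp_all
      from close[OF this] obtain N where N: "\<forall>n\<ge>N. \<forall>j\<ge>N. \<forall>p q t.
          p \<le> 2 ^ n \<longrightarrow> \<bar>real p - 2 ^ n * (t / \<tau>)\<bar> \<le> 1 \<longrightarrow> q \<le> 2 ^ j \<longrightarrow> \<bar>real q - 2 ^ j * (t / \<tau>)\<bar> \<le> 1 \<longrightarrow>
          a (T / 2) (W n p) (W j q) < c" ..
      have "a (T / 2) (W n (p n)) (W n (f t n)) < c" if "N \<le> n" for n
        by (rule N[rule_format, where t = t, OF that that p f[OF t]])
      moreover have "0 \<le> a (T / 2) (W n (p n)) (W n (f t n))" for n
        using action_cost_nonneg[OF a] W T by simp
      ultimately show "\<exists>N. \<forall>n\<ge>N. norm (a (T / 2) (W n (p n)) (W n (f t n)) - 0) < c"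
        by auto
    qed
    moreover have "(\<lambda>n. a (T / 2) (W n (f t n)) (\<omega> t)) \<longlonglongrightarrow> 0"
      using \<omega>(2)[OF t] T unfolding action_convergent_def by simp
    ultimately have lim: "(\<lambda>n. a (T / 2) (W n (p n)) (W n (f t n)) + a (T / 2) (W n (f t n)) (\<omega> t))
        \<longlonglongrightarrow> 0"
      by (rule tendsto_add_zero)
    have le: "a T (W n (p n)) (\<omega> t)
        \<le> a (T / 2) (W n (p n)) (W n (f t n)) + a (T / 2) (W n (f t n)) (\<omega> t)" for n
      using action_cost_triangle[OF a, of "T / 2" "T / 2"] W \<omega>(1)[OF t] T by simp
    have ge: "0 \<le> a T (W n (p n)) (\<omega> t)" for n
      using action_cost_nonneg[OF a T] W \<omega>(1)[OF t] by simp
    show "(\<lambda>n. a T (W n (p n)) (\<omega> t)) \<longlonglongrightarrow> 0"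
      by (rule tendsto_sandwich[OF _ _ tendsto_const lim]) (simp_all add: le ge)
  qed
  with \<omega>(1) show thesis by (rule that)
qed

text \<open>The interval \<open>[t (j - 1), t j]\<close> is approximated from inside, by the chain of level \<open>n\<close> between
  the first lattice time after \<open>t (j - 1)\<close> and the last one before \<open>t j\<close>: a shorter duration can only
  increase the cost, so the approximation errs on the right side although nothing is known about
  continuity of the cost in time. These chains are disjoint, hence their total action is at most that
  of the whole chain.\<close>

lemma dyadic_limit_curve_action_le:
  assumes a: "action_cost X a" and X: "topspace \<sigma> = X"
    and comp: "seq_compact_space \<sigma>" and lsc: "action_lsc \<sigma> a"
    and m: "\<And>\<rho> x y. 0 < \<rho> \<Longrightarrow> x \<in> X \<Longrightarrow> y \<in> X \<Longrightarrow>
      m \<rho> x y \<in> X \<and> a (\<rho> / 2) x (m \<rho> x y) + a (\<rho> / 2) (m \<rho> x y) y \<le> a \<rho> x y"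
    and \<tau>: "0 < \<tau>" and uv: "u \<in> X" "v \<in> X"
  defines "W \<equiv> dyadic_points m \<tau> u v"
  assumes \<omega>: "\<And>t. t \<in> {0..\<tau>} \<Longrightarrow> \<omega> t \<in> X"
    and conv: "\<And>t p. t \<in> {0..\<tau>} \<Longrightarrow> (\<And>n. p n \<le> 2 ^ n) \<Longrightarrow>
      (\<And>n. \<bar>real (p n) - 2 ^ n * (t / \<tau>)\<bar> \<le> 1) \<Longrightarrow> action_convergent a (\<lambda>n. W n (p n)) (\<omega> t)"
  shows "curve_action a \<tau> \<omega> \<le> ereal (a \<tau> u v)"
  unfolding curve_action_def
proof (rule Sup_least, clarify)
  fix M :: nat and t :: "nat \<Rightarrow> real"
  assume t0: "t 0 = 0" and tM: "\<tau> = t M" and "\<forall>j\<in>{1..M}. t (j - 1) < t j"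
  then have less: "t (j - 1) < t j" if "j \<in> {1..M}" for j using that by blast
  have W: "W n k \<in> X" for n k
    unfolding W_def using assms by (intro dyadic_points_in) auto
  have mono: "t i \<le> t j" if "i \<le> j" "j \<le> M" for i j
    using that
  proof (induction j rule: dec_induct)
    case (step j)
    then show ?case using less[of "Suc j"] by simp
  qed simp
  have t: "t j \<in> {0..\<tau>}" if "j \<le> M" for j
    using mono[of 0 j] mono[of j M] that t0 tM by simp
  define h where "h n = \<tau> / 2 ^ n" for n
  define f where "f n j = nat \<lfloor>2 ^ n * (t j / \<tau>)\<rfloor>" for n j
  define g where "g n j = nat \<lceil>2 ^ n * (t j / \<tau>)\<rceil>" for n j
  have h: "0 < h n" for n using \<tau> by (simp add: h_def)
  have fg: "real (f n j) = of_int \<lfloor>2 ^ n * (t j / \<tau>)\<rfloor>" "real (g n j) = of_int \<lceil>2 ^ n * (t j / \<tau>)\<rceil>"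
    "f n j \<le> 2 ^ n" "g n j \<le> 2 ^ n" "f n j \<le> g n j"
    "\<bar>real (f n j) - 2 ^ n * (t j / \<tau>)\<bar> \<le> 1" "\<bar>real (g n j) - 2 ^ n * (t j / \<tau>)\<bar> \<le> 1"
    if "j \<le> M" for n j
  proof -
    have x: "0 \<le> 2 ^ n * (t j / \<tau>)" "2 ^ n * (t j / \<tau>) \<le> 2 ^ n"
      using t[OF that] \<tau> by (auto intro: mult_left_le simp del: times_divide_eq_right)
    show f: "real (f n j) = of_int \<lfloor>2 ^ n * (t j / \<tau>)\<rfloor>" unfolding f_def using x by simp
    show g: "real (g n j) = of_int \<lceil>2 ^ n * (t j / \<tau>)\<rceil>" unfolding g_def using x by simp
    have "\<lceil>2 ^ n * (t j / \<tau>)\<rceil> \<le> (2 ^ n :: int)" using x by (simp add: ceiling_le_iff)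
    then show "g n j \<le> 2 ^ n" unfolding g_def by simp
    show "f n j \<le> g n j" unfolding f_def g_def by (intro nat_mono) linarith
    with \<open>g n j \<le> 2 ^ n\<close> show "f n j \<le> 2 ^ n" by simp
    show "\<bar>real (f n j) - 2 ^ n * (t j / \<tau>)\<bar> \<le> 1" "\<bar>real (g n j) - 2 ^ n * (t j / \<tau>)\<bar> \<le> 1"
      unfolding f g by linarith+
  qed
  define G where "G n k = (\<Sum>l<k. a (h n) (W n l) (W n (Suc l)))" for n k
  have G_mono: "G n i \<le> G n k" if "i \<le> k" for n i k
    unfolding G_def using that h W by (intro sum_mono2) (auto intro: action_cost_nonneg[OF a])
  have G_total: "G n (2 ^ n) \<le> a \<tau> u v" for n
    unfolding G_def h_def W_def using dyadic_points_sum_le[of X m a \<tau> u v n] m \<tau> uv by blast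

  \<comment> \<open>Once the mesh is below the length of the interval, the rounded end points are in order; replacing
    the left one by rounding down makes the right-hand sides telescope over \<open>j\<close>.\<close>
  have inner: "\<forall>\<^sub>F n in sequentially. a (t j - t (j - 1)) (W n (g n (j - 1))) (W n (f n j))
      \<le> G n (f n j) - G n (f n (j - 1))" if j: "j \<in> {1..M}" for j
  proof -
    have jM: "j \<le> M" "j - 1 \<le> M" using j by auto
    define d where "d = t j - t (j - 1)"
    have d: "0 < d" using less[OF j] by (simp add: d_def)
    have "\<forall>\<^sub>F n in sequentially. (1 / 2) ^ n < d / \<tau>"
      using d \<tau> by (intro order_tendstoD(2)[OF LIMSEQ_power_zero]) auto
    then show ?thesis
    proof eventually_elim
      case (elim n)
      then have "1 < 2 ^ n * (d / \<tau>)" by (simp add: power_divide field_simps)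
      then have "2 ^ n * (t (j - 1) / \<tau>) + 1 \<le> 2 ^ n * (t j / \<tau>)"
        by (simp add: d_def diff_divide_distrib right_diff_distrib)
      then have "\<lceil>2 ^ n * (t (j - 1) / \<tau>)\<rceil> \<le> \<lfloor>2 ^ n * (t j / \<tau>)\<rfloor>" by linarith
      then have "real (g n (j - 1)) \<le> real (f n j)"
        unfolding fg(1)[OF jM(1)] fg(2)[OF jM(2)] by simp
      then have gf: "g n (j - 1) \<le> f n j" by simp
      have "real (f n j) - real (g n (j - 1)) \<le> 2 ^ n * (t j / \<tau>) - 2 ^ n * (t (j - 1) / \<tau>)"
        unfolding fg(1)[OF jM(1)] fg(2)[OF jM(2)] by linarith
      then have "h n * (real (f n j) - real (g n (j - 1)))
          \<le> h n * (2 ^ n * (t j / \<tau>) - 2 ^ n * (t (j - 1) / \<tau>))"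
        using h[of n] by (intro mult_left_mono) auto
      also have "\<dots> = d" using \<tau> by (simp add: h_def d_def field_simps)
      finally have "h n * real (f n j - g n (j - 1)) \<le> d" using gf by (simp add: of_nat_diff)
      then have "a d (W n (g n (j - 1))) (W n (f n j))
          \<le> (\<Sum>l=g n (j - 1)..<f n j. a (h n) (W n l) (W n (Suc l)))"
        using gf d h W by (intro action_cost_chain_le_sum[OF a]) auto
      also have "\<dots> = G n (f n j) - G n (g n (j - 1))"
        unfolding G_def using gf by (simp add: sum_diff_nat_ivl lessThan_atLeast0 sum_diff)
      also have "\<dots> \<le> G n (f n j) - G n (f n (j - 1))"
        using G_mono[OF fg(5)[OF jM(2)]] by simp
      finally show ?case by (simp add: d_def)
    qed
  qed

  have "(\<Sum>j=1..M. a (t j - t (j - 1)) (\<omega> (t (j - 1))) (\<omega> (t j))) \<le> a \<tau> u v + real M * \<epsilon>"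
    if \<epsilon>: "0 < \<epsilon>" for \<epsilon>
  proof -
    have "\<forall>\<^sub>F n in sequentially. a (t j - t (j - 1)) (\<omega> (t (j - 1))) (\<omega> (t j))
        \<le> G n (f n j) - G n (f n (j - 1)) + \<epsilon>" if j: "j \<in> {1..M}" for j
    proof -
      have jM: "j \<le> M" "j - 1 \<le> M" using j by auto
      have "\<forall>\<^sub>F n in sequentially. a (t j - t (j - 1)) (\<omega> (t (j - 1))) (\<omega> (t j))
          < a (t j - t (j - 1)) (W n (g n (j - 1))) (W n (f n j)) + \<epsilon>"
        using less[OF j] jM W \<epsilon> fg
        by (intro action_lsc_action_convergent[OF a X comp lsc] conv \<omega> t) auto
      with inner[OF j] show ?thesis by eventually_elim linarith
    qed
    then have "\<forall>\<^sub>F n in sequentially. \<forall>j\<in>{1..M}. a (t j - t (j - 1)) (\<omega> (t (j - 1))) (\<omega> (t j))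
        \<le> G n (f n j) - G n (f n (j - 1)) + \<epsilon>"
      by (intro eventually_ball_finite) auto
    then obtain n where n: "\<And>j. j \<in> {1..M} \<Longrightarrow> a (t j - t (j - 1)) (\<omega> (t (j - 1))) (\<omega> (t j))
        \<le> G n (f n j) - G n (f n (j - 1)) + \<epsilon>"
      using eventually_happens'[OF sequentially_bot] by blast
    have "(\<Sum>j=1..M. a (t j - t (j - 1)) (\<omega> (t (j - 1))) (\<omega> (t j)))
        \<le> (\<Sum>j=1..M. G n (f n j) - G n (f n (j - 1)) + \<epsilon>)"
      by (intro sum_mono n) auto
    also have "\<dots> = G n (f n M) - G n (f n 0) + real M * \<epsilon>"
      using sum_telescope''[of 0 M "\<lambda>j. G n (f n j)"] by (simp add: sum.distrib)
    also have "\<dots> \<le> a \<tau> u v + real M * \<epsilon>"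
      using order_trans[OF G_mono[OF fg(3)[OF order_refl]] G_total, of n] t0
      by (simp add: G_def f_def[of n 0])
    finally show ?thesis .
  qed
  note bound = this
  have "(\<Sum>j=1..M. a (t j - t (j - 1)) (\<omega> (t (j - 1))) (\<omega> (t j))) \<le> a \<tau> u v"
  proof (rule field_le_epsilon)
    fix e :: real assume "0 < e"
    then have "real M * (e / (real M + 1)) \<le> e" by (simp add: field_simps)
    with bound[of "e / (real M + 1)"] \<open>0 < e\<close>
    show "(\<Sum>j=1..M. a (t j - t (j - 1)) (\<omega> (t (j - 1))) (\<omega> (t j))) \<le> a \<tau> u v + e" by simp
  qed
  then show "ereal (\<Sum>j=1..M. a (t j - t (j - 1)) (\<omega> (t (j - 1))) (\<omega> (t j))) \<le> ereal (a (t M) u v)"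
    using tM by simp
qed

theorem theorem8p3:
  fixes X :: "'a set" and a :: "real \<Rightarrow> 'a \<Rightarrow> 'a \<Rightarrow> real" and \<sigma> :: "'a topology"
  assumes "action_cost X a"
    and "action_complete X a"
    and "approx_midpoint X a"
    and "uniformly_superlinear X a"
    and "topspace \<sigma> = X"
    and "seq_compact_space \<sigma>"
    and "action_lsc \<sigma> a"
  shows "\<forall>\<tau>>0. \<forall>u0\<in>X. \<forall>u1\<in>X. \<exists>\<omega>\<in>curves_between X \<tau> u0 u1.
           ereal (a \<tau> u0 u1) = curve_action a \<tau> \<omega> \<and>
           (\<forall>\<Theta>\<in>curves_between X \<tau> u0 u1. curve_action a \<tau> \<omega> \<le> curve_action a \<tau> \<Theta>)"
proof (intro allI impI ballI)
  fix \<tau> :: real and u0 u1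
  assume \<tau>: "0 < \<tau>" and u: "u0 \<in> X" "u1 \<in> X"
  have "\<exists>w. 0 < \<rho> \<longrightarrow> x \<in> X \<longrightarrow> y \<in> X \<longrightarrow> w \<in> X \<and> a (\<rho> / 2) x w + a (\<rho> / 2) w y \<le> a \<rho> x y" for \<rho> x y
    using exact_midpoint[OF assms(1,3,5-7), of \<rho> x y] by blast
  then obtain m where m: "\<And>\<rho> x y. 0 < \<rho> \<Longrightarrow> x \<in> X \<Longrightarrow> y \<in> X \<Longrightarrow>
      m \<rho> x y \<in> X \<and> a (\<rho> / 2) x (m \<rho> x y) + a (\<rho> / 2) (m \<rho> x y) y \<le> a \<rho> x y"
    by metis
  define W where "W = dyadic_points m \<tau> u0 u1"
  obtain \<omega> where \<omega>: "\<And>t. t \<in> {0..\<tau>} \<Longrightarrow> \<omega> t \<in> X"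
    and conv: "\<And>t p. t \<in> {0..\<tau>} \<Longrightarrow> (\<And>n. p n \<le> 2 ^ n) \<Longrightarrow>
      (\<And>n. \<bar>real (p n) - 2 ^ n * (t / \<tau>)\<bar> \<le> 1) \<Longrightarrow> action_convergent a (\<lambda>n. W n (p n)) (\<omega> t)"
    unfolding W_def using dyadic_limit_curve[OF assms(1,2,4) m \<tau> u] by blast
  have const: "action_convergent a (\<lambda>_. x) x" if "x \<in> X" for x
    unfolding action_convergent_def using that action_cost_eq_0_iff[OF assms(1), of _ x x] by simp
  have "action_convergent a (\<lambda>n. W n 0) (\<omega> 0)" "action_convergent a (\<lambda>n. W n (2 ^ n)) (\<omega> \<tau>)"
    using conv[of 0 "\<lambda>_. 0"] conv[of \<tau> "\<lambda>n. 2 ^ n"] \<tau> by simp_all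
  then have ends: "\<omega> 0 = u0" "\<omega> \<tau> = u1"
    using action_convergent_unique[OF assms(1) _ _ _ _ const] \<omega>[of 0] \<omega>[of \<tau>] \<tau> u
    unfolding W_def dyadic_points_first dyadic_points_last by auto
  then have curve: "\<omega> \<in> curves_between X \<tau> u0 u1" using \<omega> by (auto simp: curves_between_def)
  have upper: "curve_action a \<tau> \<omega> \<le> ereal (a \<tau> u0 u1)"
    by (rule dyadic_limit_curve_action_le[OF assms(1,5-7) m \<tau> u \<omega> conv[unfolded W_def]])
  have lower: "ereal (a \<tau> u0 u1) \<le> curve_action a \<tau> \<Theta>" if "\<Theta> \<in> curves_between X \<tau> u0 u1" for \<Theta>
    using curve_action_ge[OF \<tau>, of a \<Theta>] that by (simp add: curves_between_def)
  show "\<exists>\<omega>\<in>curves_between X \<tau> u0 u1. ereal (a \<tau> u0 u1) = curve_action a \<tau> \<omega> \<and>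
      (\<forall>\<Theta>\<in>curves_between X \<tau> u0 u1. curve_action a \<tau> \<omega> \<le> curve_action a \<tau> \<Theta>)"
  proof (intro bexI[OF _ curve] conjI ballI)
    fix \<Theta> assume "\<Theta> \<in> curves_between X \<tau> u0 u1"
    then show "curve_action a \<tau> \<omega> \<le> curve_action a \<tau> \<Theta>"
      using order_trans[OF upper lower] by blast
  qed (use antisym[OF lower[OF curve] upper] in simp)
qed

end
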